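(* Let $H$ be a real Hilbert space continuously embedded in a real Banach space $L$, $a:H\times H\to\mathbb{R}$ a continuous bilinear form and $\ell:H\to\mathbb{R}$ a continuous linear form. Let $X_h$, $Y_h$ be real normed vector spaces, $a_h:X_h\times Y_h\to\mathbb{R}$ a bilinear form, $\ell_h:Y_h\to\mathbb{R}$ a linear form, and $r_h:X_h\to L$ a linear operator. Assume that, for every $g\in L^\star$, the dual problem $$\text{find }z_g\in H\text{ such that}\quad a(w,z_g)=g(w)\quad\forall w\in H$$ has a solution $z_g$. Let $B_{L^\star}=\{g\in L^\star:\|g\|_{L^\star}\le1\}$. Let $u\in H$ be a solution of $a(u,v)=\ell(v)$ for all $v\in H$, and $u_h\in X_h$ a solution of $a_h(u_h,v_h)=\ell_h(v_h)$ for all $v_h\in Y_h$. Take $I_hu\in X_h$ and, for each $g\in B_{L^\star}$, take $J_hz_g\in Y_h$. Then $$\|r_h(u_h-I_hu)\|_L\le\|u_h-I_hu\|_{X_h}\sup_{g\in B_{L^\star}}\|\mathcal{E}_h^{\mathrm d}(z_g;\cdot)\|_{X_h^\star}+\sup_{g\in B_{L^\star}}\mathcal{E}_h(u;J_hz_g),$$ where $\mathcal{E}_h(u;\cdot)=\ell_h(\cdot)-a_h(I_hu,\cdot):Y_h\to\mathbb{R}$ is the (primal) variational consistency error and $\mathcal{E}_h^{\mathrm d}(z_g;\cdot)=g\circ r_h-a_h(\cdot,J_hz_g):X_h\to\mathbb{R}$ is the dual consistency error.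
   Context: $L^\star$ is the space of continuous linear forms $L\to\mathbb{R}$ with its usual dual norm; for $w\in H$, $g(w)$ uses the embedding $H\hookrightarrow L$. The spaces $X_h$ and $Y_h$ are not assumed to be spaces of functions, and $I_hu\in X_h$ and $J_hz_g\in Y_h$ are arbitrary given elements. For a linear form $\mu:Z\to\mathbb{R}$ on a normed space $Z$, $\|\mu\|_{Z^\star}=\sup_{z\in Z\setminus\{0\}}\frac{|\mu(z)|}{\|z\|_Z}\in[0,+\infty]$; suprema are allowed to take the value $+\infty$, with $0\cdot(+\infty)=0$. *)

theory Defs
  imports "HOL-Analysis.Analysis"
begin

(* Dual norm of a linear form that need not be bounded, with values in [0, infinity].
   Taking the supremum in ennreal makes it 0 on the zero space (empty supremum). *)
definition dual_norm :: "('z::real_normed_vector \<Rightarrow> real) \<Rightarrow> ennreal" where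
  "dual_norm \<mu> = (SUP z\<in>UNIV - {0}. ennreal (\<bar>\<mu> z\<bar> / norm z))"

definition continuous_embedding :: "('h::real_normed_vector \<Rightarrow> 'l::real_normed_vector) \<Rightarrow> bool" where
  "continuous_embedding \<iota> \<longleftrightarrow> bounded_linear \<iota> \<and> inj \<iota>"

definition solves_dual_problem ::
  "('h \<Rightarrow> 'h \<Rightarrow> real) \<Rightarrow> ('h \<Rightarrow> 'l::real_normed_vector) \<Rightarrow> ('l \<Rightarrow>\<^sub>L real) \<Rightarrow> 'h \<Rightarrow> bool" where
  "solves_dual_problem a \<iota> g z \<longleftrightarrow> (\<forall>w. a w z = blinfun_apply g (\<iota> w))"

(* The consistency errors depend on u and z_g only through the given discrete elements
   Iu = I_h u and Jz = J_h z_g, which are therefore the arguments here. *)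
definition primal_consistency_error ::
  "('x \<Rightarrow> 'y \<Rightarrow> real) \<Rightarrow> ('y \<Rightarrow> real) \<Rightarrow> 'x \<Rightarrow> 'y \<Rightarrow> real" where
  "primal_consistency_error ah lh Iu = (\<lambda>v. lh v - ah Iu v)"

definition dual_consistency_error ::
  "('x \<Rightarrow> 'y \<Rightarrow> real) \<Rightarrow> ('x \<Rightarrow> 'l::real_normed_vector) \<Rightarrow> ('l \<Rightarrow>\<^sub>L real) \<Rightarrow> 'y \<Rightarrow> 'x \<Rightarrow> real" where
  "dual_consistency_error ah rh g Jz = (\<lambda>x. blinfun_apply g (rh x) - ah x Jz)"

end

theory Submission
  imports Defs
begin

text \<open>By Hahn--Banach there is a functional \<open>g\<close> in the dual unit ball with
  \<open>g (r_h (u_h - I_h u)) = norm (r_h (u_h - I_h u))\<close>. Split it as the dual consistency error at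
  \<open>u_h - I_h u\<close> plus \<open>a_h (u_h - I_h u) (J_h z_g)\<close>; the discrete equation turns
  the latter into the primal consistency error at \<open>J_h z_g\<close>.

  For Hahn--Banach, a sublinear functional that is pointwise minimal among sublinear ones is
  linear, and Zorn's lemma provides such a functional below any given one.\<close>

section \<open>Sublinear functionals and minimality\<close>

text \<open>Homogeneity is asked only as an inequality for \<open>0 < c\<close>, so that infima are
  easy to check; applying it to \<open>inverse c\<close> gives equality.\<close>

definition sublinear :: "('a::real_vector \<Rightarrow> real) \<Rightarrow> bool" where
  "sublinear p \<longleftrightarrow> (\<forall>x y. p (x + y) \<le> p x + p y) \<and> (\<forall>c x. 0 < c \<longrightarrow> p (c *\<^sub>R x) \<le> c * p x)"

lemma sublinear_add: "sublinear p \<Longrightarrow> p (x + y) \<le> p x + p y"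
  by (simp add: sublinear_def)

lemma sublinear_scaleR:
  assumes "sublinear p" "0 < c"
  shows "p (c *\<^sub>R x) = c * p x"
proof (rule antisym)
  show "p (c *\<^sub>R x) \<le> c * p x"
    using assms by (simp add: sublinear_def)
  have "p (inverse c *\<^sub>R (c *\<^sub>R x)) \<le> inverse c * p (c *\<^sub>R x)"
    using assms unfolding sublinear_def by (meson positive_imp_inverse_positive)
  then show "c * p x \<le> p (c *\<^sub>R x)"
    using assms(2) by (simp add: field_simps)
qed

lemma sublinear_zero: "sublinear p \<Longrightarrow> p 0 = 0"
  using sublinear_scaleR[of p 2 0] by simp

lemma sublinear_ge_minus: "sublinear p \<Longrightarrow> - p (- x) \<le> p x"
  using sublinear_add[of p x "- x"] sublinear_zero[of p] by simp

lemma sublinear_norm: "sublinear norm"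
  by (simp add: sublinear_def norm_triangle_ineq)

text \<open>The greatest sublinear functional below \<open>p\<close> that takes the value \<open>- p x\<close> at \<open>- x\<close>.\<close>

definition shifted_inf :: "('a::real_vector \<Rightarrow> real) \<Rightarrow> 'a \<Rightarrow> 'a \<Rightarrow> real" where
  "shifted_inf p x y = (INF t\<in>{0..}. p (y + t *\<^sub>R x) - t * p x)"

text \<open>A real infimum bounds its terms only if they are bounded below. Here
  \<open>- p (- y)\<close> is a lower bound: \<open>s *\<^sub>R x\<close> is the sum of
  \<open>y + s *\<^sub>R x\<close> and \<open>- y\<close>, and
  \<open>p (s *\<^sub>R x) = s * p x\<close> for \<open>0 < s\<close>.\<close>

lemma shifted_inf_le:
  assumes "sublinear p" "0 \<le> t"
  shows "shifted_inf p x y \<le> p (y + t *\<^sub>R x) - t * p x"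
proof -
  have "- p (- y) \<le> p (y + s *\<^sub>R x) - s * p x" if "0 \<le> s" for s
  proof (cases "s = 0")
    case True
    then show ?thesis
      using sublinear_ge_minus[OF assms(1)] by simp
  next
    case False
    then show ?thesis
      using sublinear_add[OF assms(1), of "y + s *\<^sub>R x" "- y"]
        sublinear_scaleR[OF assms(1), of s x] that by simp
  qed
  then have "bdd_below ((\<lambda>t. p (y + t *\<^sub>R x) - t * p x) ` {0..})"
    by (auto intro!: bdd_belowI2)
  then show ?thesis
    unfolding shifted_inf_def using assms(2) by (intro cINF_lower) auto
qed

lemma shifted_inf_greatest:
  assumes "\<And>t. 0 \<le> t \<Longrightarrow> m \<le> p (y + t *\<^sub>R x) - t * p x"
  shows "m \<le> shifted_inf p x y"
  unfolding shifted_inf_def by (rule cINF_greatest) (use assms in auto)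

text \<open>Parameters \<open>s\<close> for \<open>y\<close> and \<open>t\<close> for
  \<open>z\<close> combine to \<open>s + t\<close> for \<open>y + z\<close>, and \<open>t\<close>
  for \<open>y\<close> becomes \<open>c * t\<close> for \<open>c *\<^sub>R y\<close>; then infima
  are taken one parameter at a time.\<close>

lemma sublinear_shifted_inf:
  assumes "sublinear p"
  shows "sublinear (shifted_inf p x)"
  unfolding sublinear_def
proof (intro conjI allI impI)
  fix y z
  have "shifted_inf p x (y + z) - (p (z + t *\<^sub>R x) - t * p x) \<le> p (y + s *\<^sub>R x) - s * p x"
    if "0 \<le> s" "0 \<le> t" for s t
    using shifted_inf_le[OF assms, of "s + t" x "y + z"] that
      sublinear_add[OF assms, of "y + s *\<^sub>R x" "z + t *\<^sub>R x"]
    by (simp add: algebra_simps)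
  then have "shifted_inf p x (y + z) - (p (z + t *\<^sub>R x) - t * p x) \<le> shifted_inf p x y"
    if "0 \<le> t" for t
    using that by (intro shifted_inf_greatest) auto
  then have "shifted_inf p x (y + z) - shifted_inf p x y \<le> shifted_inf p x z"
    by (intro shifted_inf_greatest) (simp add: algebra_simps)
  then show "shifted_inf p x (y + z) \<le> shifted_inf p x y + shifted_inf p x z"
    by simp
next
  fix c :: real and y
  assume "0 < c"
  have "shifted_inf p x (c *\<^sub>R y) / c \<le> p (y + t *\<^sub>R x) - t * p x" if "0 \<le> t" for t
    using shifted_inf_le[OF assms, of "c * t" x "c *\<^sub>R y"] that \<open>0 < c\<close>
      sublinear_scaleR[OF assms \<open>0 < c\<close>, of "y + t *\<^sub>R x"]
    by (simp add: field_simps)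
  then have "shifted_inf p x (c *\<^sub>R y) / c \<le> shifted_inf p x y"
    by (rule shifted_inf_greatest)
  then show "shifted_inf p x (c *\<^sub>R y) \<le> c * shifted_inf p x y"
    using \<open>0 < c\<close> by (simp add: field_simps)
qed

text \<open>Minimality forces \<open>shifted_inf q x = q\<close> for every \<open>x\<close>. The
  term with parameter 1 then says that \<open>q\<close> is superadditive, hence additive.\<close>

lemma minimal_sublinear_imp_linear:
  assumes "sublinear q" and minimal: "\<And>r. sublinear r \<Longrightarrow> r \<le> q \<Longrightarrow> r = q"
  shows "linear q"
proof -
  have "shifted_inf q x = q" for x
  proof (rule minimal[OF sublinear_shifted_inf[OF assms(1)]], rule le_funI)
    \<comment> \<open>The term with parameter 0 is \<open>q y\<close> itself.\<close>
    show "shifted_inf q x y \<le> q y" for y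
      using shifted_inf_le[OF assms(1), of 0 x y] by simp
  qed
  then have "q y \<le> q (y + x) - q x" for x y
    using shifted_inf_le[OF assms(1), of 1 x y] by simp
  then have add: "q (x + y) = q x + q y" for x y
    using sublinear_add[OF assms(1), of x y] by (smt (verit) add.commute)
  have minus: "q (- x) = - q x" for x
    using add[of x "- x"] sublinear_zero[OF assms(1)] by simp
  have "q (c *\<^sub>R x) = c * q x" for c x
  proof -
    consider "0 < c" | "c = 0" | "0 < - c"
      by linarith
    then show ?thesis
    proof cases
      case 3
      then show ?thesis
        using sublinear_scaleR[OF assms(1) 3, of x] minus[of "c *\<^sub>R x"] by simp
    qed (use sublinear_scaleR[OF assms(1)] sublinear_zero[OF assms(1)] in auto)
  qed
  then show ?thesis
    using add by (intro linearI) auto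
qed

section \<open>The Hahn-Banach theorem by Zorn's lemma\<close>

text \<open>Subadditivity can fail for the infimum of an arbitrary family. In a chain, the smaller
  of \<open>q\<close> and \<open>r\<close> can be used for both arguments, which bounds the infimum
  at \<open>x + y\<close> by \<open>q x + r y\<close>.\<close>

lemma sublinear_INF_chain:
  assumes "C \<noteq> {}" and sub: "\<And>q. q \<in> C \<Longrightarrow> sublinear q"
    and chain: "\<And>q r. q \<in> C \<Longrightarrow> r \<in> C \<Longrightarrow> q \<le> r \<or> r \<le> q"
    and bdd: "\<And>x. bdd_below ((\<lambda>q. q x) ` C)"
  shows "sublinear (\<lambda>x. INF q\<in>C. q x)"
  unfolding sublinear_def
proof (intro conjI allI impI)
  have lower: "(INF q\<in>C. q x) \<le> q x" if "q \<in> C" for q x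
    using bdd that by (rule cINF_lower)
  have greatest: "m \<le> (INF q\<in>C. q x)" if "\<And>q. q \<in> C \<Longrightarrow> m \<le> q x" for m x
    using assms(1) that by (rule cINF_greatest)
  fix x y
  have "(INF q\<in>C. q (x + y)) \<le> q x + r y" if "q \<in> C" "r \<in> C" for q r
    using chain[OF that]
  proof
    assume "q \<le> r"
    then show ?thesis
      using lower[OF that(1), of "x + y"] sublinear_add[OF sub[OF that(1)], of x y]
      by (smt (verit) le_funD)
  next
    assume "r \<le> q"
    then show ?thesis
      using lower[OF that(2), of "x + y"] sublinear_add[OF sub[OF that(2)], of x y]
      by (smt (verit) le_funD)
  qed
  then have "(INF q\<in>C. q (x + y)) - r y \<le> (INF q\<in>C. q x)" if "r \<in> C" for r
    using that by (intro greatest) (simp add: algebra_simps)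
  then have "(INF q\<in>C. q (x + y)) - (INF q\<in>C. q x) \<le> (INF q\<in>C. q y)"
    by (intro greatest) (simp add: algebra_simps)
  then show "(INF q\<in>C. q (x + y)) \<le> (INF q\<in>C. q x) + (INF q\<in>C. q y)"
    by simp
  fix c :: real
  assume "0 < c"
  have "(INF q\<in>C. q (c *\<^sub>R x)) / c \<le> q x" if "q \<in> C" for q
    using lower[OF that, of "c *\<^sub>R x"] sublinear_scaleR[OF sub[OF that] \<open>0 < c\<close>, of x] \<open>0 < c\<close>
    by (simp add: field_simps)
  then have "(INF q\<in>C. q (c *\<^sub>R x)) / c \<le> (INF q\<in>C. q x)"
    by (rule greatest)
  then show "(INF q\<in>C. q (c *\<^sub>R x)) \<le> c * (INF q\<in>C. q x)"
    using \<open>0 < c\<close> by (simp add: field_simps)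
qed

theorem hahn_banach_sublinear:
  assumes "sublinear p"
  shows "\<exists>f. linear f \<and> f \<le> p"
proof -
  define A where "A = {q. sublinear q \<and> q \<le> p}"
  have "\<exists>q\<in>A. \<forall>r\<in>A. r \<le> q \<longrightarrow> r = q"
  \<comment> \<open>The order is reversed, so that a maximal element is a minimal functional and
    chains need lower bounds.\<close>
  proof (rule predicate_Zorn[where P = "\<lambda>q r. r \<le> q"])
    show "partial_order_on A (relation_of (\<lambda>q r. r \<le> q) A)"
      by (rule partial_order_on_relation_ofI) auto
  next
    fix C
    assume "C \<in> Chains (relation_of (\<lambda>q r. r \<le> q) A)"
    then have "C \<subseteq> A" and chain: "\<And>q r. q \<in> C \<Longrightarrow> r \<in> C \<Longrightarrow> q \<le> r \<or> r \<le> q"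
      by (auto simp: Chains_def relation_of_def)
    then have sub: "sublinear q" and le: "q \<le> p" if "q \<in> C" for q
      using that by (auto simp: A_def)
    show "\<exists>u\<in>A. \<forall>q\<in>C. u \<le> q"
    \<comment> \<open>The infimum over an empty set of reals carries no information, so
      \<open>p\<close> itself bounds the empty chain.\<close>
    proof (cases "C = {}")
      case True
      then show ?thesis
        using assms by (auto simp: A_def)
    next
      case False
      \<comment> \<open>A bound common to all members of the chain: \<open>q \<le> p\<close> is used
        at \<open>- x\<close>.\<close>
      have "- p (- x) \<le> q x" if "q \<in> C" for q x
        using sublinear_ge_minus[OF sub[OF that], of x] le_funD[OF le[OF that], of "- x"] by simp
      then have bdd: "bdd_below ((\<lambda>q. q x) ` C)" for x
        by (rule bdd_belowI2)
      define u where "u = (\<lambda>x. INF q\<in>C. q x)"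
      have "sublinear u"
        unfolding u_def using False sub chain bdd by (rule sublinear_INF_chain)
      moreover have below: "u \<le> q" if "q \<in> C" for q
        unfolding u_def using bdd that by (intro le_funI cINF_lower)
      moreover have "u \<le> p"
        using False below le by (meson ex_in_conv order_trans)
      ultimately show ?thesis
        by (auto simp: A_def)
    qed
  qed
  then obtain q where "q \<in> A" and minimal: "\<And>r. r \<in> A \<Longrightarrow> r \<le> q \<Longrightarrow> r = q"
    by blast
  then have "sublinear q" "q \<le> p"
    by (auto simp: A_def)
  moreover have "linear q"
    using \<open>sublinear q\<close>
    by (rule minimal_sublinear_imp_linear) (use minimal \<open>q \<le> p\<close> in \<open>auto simp: A_def\<close>)
  ultimately show ?thesis
    by blast
qed

text \<open>Domination by \<open>shifted_inf norm x\<close> instead of \<open>norm\<close> pins down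
  the value at \<open>x\<close>, and so does the work of extending a functional from the span of
  \<open>x\<close>.\<close>

corollary norming_functional_exists:
  fixes x :: "'a::real_normed_vector"
  obtains g :: "'a \<Rightarrow>\<^sub>L real" where "norm g \<le> 1" "blinfun_apply g x = norm x"
proof -
  obtain f :: "'a \<Rightarrow> real" where "linear f" and f: "f \<le> shifted_inf norm x"
    using hahn_banach_sublinear[OF sublinear_shifted_inf[OF sublinear_norm]] by blast
  have le: "f y \<le> norm y" for y
    using le_funD[OF f, of y] shifted_inf_le[OF sublinear_norm, of 0 x y] by simp
  have bound: "\<bar>f y\<bar> \<le> norm y" for y
    using le[of y] le[of "- y"] linear_neg[OF \<open>linear f\<close>, of y] by simp
  have "bounded_linear f"
    by (rule bounded_linear_intro[where K = 1])
      (use bound in \<open>auto simp: linear_add[OF \<open>linear f\<close>] linear_cmul[OF \<open>linear f\<close>]\<close>)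
  then have f_apply: "blinfun_apply (Blinfun f) = f"
    by (rule bounded_linear_Blinfun_apply)
  \<comment> \<open>Parameter 1 makes the argument of the norm \<open>- x + x = 0\<close>, leaving
    \<open>- norm x\<close>.\<close>
  have "f (- x) \<le> - norm x"
    using le_funD[OF f, of "- x"] shifted_inf_le[OF sublinear_norm, of 1 x "- x"] by simp
  then have "f x = norm x"
    using le[of x] linear_neg[OF \<open>linear f\<close>, of x] by simp
  moreover have "norm (Blinfun f) \<le> 1"
    using bound by (intro norm_blinfun_bound) (auto simp: f_apply)
  ultimately show thesis
    using that[of "Blinfun f"] by (simp add: f_apply)
qed

section \<open>The consistency estimate\<close>

text \<open>The supremum skips the zero vector, so \<open>x = 0\<close> is treated apart: there the
  right-hand side is 0 even for an infinite dual norm, and \<open>\<mu> 0 = 0\<close> closes the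
  case.\<close>

lemma abs_le_norm_times_dual_norm:
  assumes "\<mu> 0 = 0"
  shows "ereal \<bar>\<mu> x\<bar> \<le> ereal (norm x) * enn2ereal (dual_norm \<mu>)"
proof (cases "x = 0")
  case True
  then show ?thesis
    using assms by (simp flip: zero_ereal_def)
next
  case False
  then have "ennreal (\<bar>\<mu> x\<bar> / norm x) \<le> dual_norm \<mu>"
    unfolding dual_norm_def by (intro SUP_upper) auto
  then have "ereal (\<bar>\<mu> x\<bar> / norm x) \<le> enn2ereal (dual_norm \<mu>)"
    by (metis abs_ge_zero divide_nonneg_nonneg enn2ereal_ennreal less_eq_ennreal.rep_eq norm_ge_zero)
  then have "ereal (norm x) * ereal (\<bar>\<mu> x\<bar> / norm x) \<le> ereal (norm x) * enn2ereal (dual_norm \<mu>)"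
    by (intro ereal_mult_left_mono) auto
  then show ?thesis
    using False by simp
qed

theorem theorem13:
  fixes \<iota> :: "'h::{real_inner, complete_space} \<Rightarrow> 'l::banach"
    and a :: "'h \<Rightarrow> 'h \<Rightarrow> real"
    and l :: "'h \<Rightarrow> real"
    and ah :: "'x::real_normed_vector \<Rightarrow> 'y::real_normed_vector \<Rightarrow> real"
    and lh :: "'y \<Rightarrow> real"
    and rh :: "'x \<Rightarrow> 'l"
    and z :: "('l \<Rightarrow>\<^sub>L real) \<Rightarrow> 'h"
    and u :: 'h
    and uh Iu :: 'x
    and Jz :: "('l \<Rightarrow>\<^sub>L real) \<Rightarrow> 'y"
  assumes "continuous_embedding \<iota>"
    and "bounded_bilinear a"
    and "bounded_linear l"
    and "bilinear ah"
    and "linear lh"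
    and "linear rh"
    and "\<And>g. solves_dual_problem a \<iota> g (z g)"
    and "\<And>v. a u v = l v"
    and "\<And>v. ah uh v = lh v"
  shows "ereal (norm (rh (uh - Iu)))
    \<le> ereal (norm (uh - Iu))
        * enn2ereal (SUP g\<in>cball 0 1. dual_norm (dual_consistency_error ah rh g (Jz g)))
      + (SUP g\<in>cball 0 1. ereal (primal_consistency_error ah lh Iu (Jz g)))"
proof -
  let ?e = "uh - Iu"
  obtain g :: "'l \<Rightarrow>\<^sub>L real" where "norm g \<le> 1" and norming: "blinfun_apply g (rh ?e) = norm (rh ?e)"
    by (rule norming_functional_exists)
  then have g: "g \<in> cball 0 1"
    by simp
  define d where "d = dual_consistency_error ah rh g (Jz g)"
  have "d 0 = 0"
    unfolding d_def dual_consistency_error_def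
    using bilinear_lzero[OF \<open>bilinear ah\<close>] linear_0[OF \<open>linear rh\<close>] by simp
  have "norm (rh ?e) = d ?e + primal_consistency_error ah lh Iu (Jz g)"
    using norming bilinear_lsub[OF \<open>bilinear ah\<close>] assms(9)
    by (simp add: d_def dual_consistency_error_def primal_consistency_error_def)
  \<comment> \<open>Only the dual error passes to its absolute value; the primal error keeps its
    sign, as in the second supremum.\<close>
  then have "ereal (norm (rh ?e)) \<le> ereal \<bar>d ?e\<bar> + ereal (primal_consistency_error ah lh Iu (Jz g))"
    by simp
  also have "\<dots> \<le> ereal (norm ?e)
        * enn2ereal (SUP g\<in>cball 0 1. dual_norm (dual_consistency_error ah rh g (Jz g)))
      + (SUP g\<in>cball 0 1. ereal (primal_consistency_error ah lh Iu (Jz g)))"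
  \<comment> \<open>Both suprema dominate their terms at the norming \<open>g\<close>; in the
    extended reals this holds even if they are infinite.\<close>
  proof (rule add_mono)
    have "dual_norm d \<le> (SUP g\<in>cball 0 1. dual_norm (dual_consistency_error ah rh g (Jz g)))"
      unfolding d_def using g by (rule SUP_upper)
    then have "ereal (norm ?e) * enn2ereal (dual_norm d) \<le> ereal (norm ?e)
        * enn2ereal (SUP g\<in>cball 0 1. dual_norm (dual_consistency_error ah rh g (Jz g)))"
      by (intro ereal_mult_left_mono) (auto simp: less_eq_ennreal.rep_eq)
    then show "ereal \<bar>d ?e\<bar> \<le> ereal (norm ?e)
        * enn2ereal (SUP g\<in>cball 0 1. dual_norm (dual_consistency_error ah rh g (Jz g)))"
      using abs_le_norm_times_dual_norm[of d ?e, OF \<open>d 0 = 0\<close>] by (rule order_trans[rotated])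
    show "ereal (primal_consistency_error ah lh Iu (Jz g))
      \<le> (SUP g\<in>cball 0 1. ereal (primal_consistency_error ah lh Iu (Jz g)))"
      using g by (rule SUP_upper)
  qed
  finally show ?thesis .
qed

end
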